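(* Let $(a_n)_{n\ge1}$ be a sequence of real or complex numbers and let $(X_n)_{n\ge1}$ be a sequence of real random variables on a common probability space such that $\mathbb{E}(X_n^2)=1$ for all $n$ and $\mathbb{E}(X_nX_m)\le 0$ for all $n\neq m$. If $$\sum_{n=1}^\infty|a_n|^2\log_2^2(n+1)<\infty,$$ then the series $\sum_{n=1}^\infty a_nX_n$ converges almost surely.
   Context: $\log_2$ denotes the base-2 logarithm and $\log_2^2(x)=(\log_2 x)^2$. *)

theory Defs
  imports "HOL-Probability.Probability"
begin

end

theory Submission
  imports Defs "HOL-Library.Discrete_Functions"
begin

text \<open>
  The argument is the Rademacher--Menshov method, in the variant that only needs an upper bound
  for second moments.

  If the coefficients \<open>b n\<close> are nonnegative, then the nonpositive correlations make all cross terms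
  \<open>b n * b m * E (X n * X m)\<close> nonpositive, so that the second moment of a sum of \<open>b n * X n\<close> over any
  finite set of indices is at most the sum of the \<open>(b n)\<^sup>2\<close>
  (\<open>second_moment_sum_le\<close>).  A complex coefficient sequence is a linear combination of four
  nonnegative ones, namely the positive and negative parts of its real and imaginary parts, and
  each of them is dominated by the modulus.  Hence it suffices to treat nonnegative coefficients.

  For these, the indices are split into the dyadic blocks from \<open>2 ^ k\<close> to \<open>2 ^ Suc k - 1\<close>.
  A partial sum inside a block of length \<open>2 ^ k\<close> decomposes along binary digits into at most
  \<open>k + 1\<close> dyadic sums, so by Cauchy--Schwarz its square is at most \<open>k + 1\<close> times
  a fixed sum of squares of dyadic sums (\<open>square_prefix_sum_le\<close>), whose expectation is at most
  \<open>k + 1\<close> times the sum \<open>A k\<close> of the \<open>(b n)\<^sup>2\<close> over the block.  Thus the maximal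
  oscillation within block \<open>k\<close> has second moment at most \<open>(k + 1)\<^sup>2 * A k\<close>, and this is summable
  because \<open>k + 1\<close> is at most twice \<open>log 2 (n + 1)\<close> in block \<open>k\<close>.  So these oscillations almost
  surely tend to 0.  The block sums \<open>T k\<close> themselves are almost surely absolutely summable, since
  \<open>(k + 1)\<^sup>2 * (T k)\<^sup>2\<close> is almost surely summable for the same reason.  Both facts together give
  convergence of the series (\<open>summable_if_dyadic_control\<close>).
\<close>

section \<open>Partial sums and dyadic blocks\<close>

text \<open>
  A sum of squares that dominates all prefix sums of the block of length \<open>2 ^ k\<close> starting at \<open>s\<close>.
  A prefix longer than half of the block is its full left half plus a prefix of the right half;
  therefore the recursion records only the left half's sum, besides the two recursive terms.
\<close>

fun dyadic_squares :: "(nat \<Rightarrow> real) \<Rightarrow> nat \<Rightarrow> nat \<Rightarrow> real" where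
  "dyadic_squares x 0 s = (x s)\<^sup>2"
| "dyadic_squares x (Suc k) s =
     dyadic_squares x k s + dyadic_squares x k (s + 2 ^ k) + (sum x {s..<s + 2 ^ k})\<^sup>2"

lemma dyadic_squares_nonneg: "0 \<le> dyadic_squares x k s"
  by (induction k arbitrary: s) auto

text \<open>
  The step from \<open>c\<close> to \<open>c + 1\<close> levels in Cauchy--Schwarz: peeling off one summand costs one unit
  in the constant.
\<close>

lemma square_add_le_weighted:
  fixes u v c d :: real
  assumes "0 < c" "v\<^sup>2 \<le> c * d"
  shows "(u + v)\<^sup>2 \<le> (c + 1) * (u\<^sup>2 + d)"
proof -
  have "0 \<le> (c * u - v)\<^sup>2" by simp
  then have "c * (2 * u * v) \<le> c * (c * u\<^sup>2) + v\<^sup>2"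
    by (simp add: power2_eq_square algebra_simps)
  also have "\<dots> \<le> c * (c * u\<^sup>2) + c * d"
    using assms by simp
  also have "\<dots> = c * (c * u\<^sup>2 + d)" by (simp add: algebra_simps)
  finally have "2 * u * v \<le> c * u\<^sup>2 + d"
    using assms(1) by simp
  then show ?thesis
    using assms(2) by (simp add: power2_eq_square algebra_simps)
qed

lemma square_prefix_sum_le:
  assumes "m \<le> 2 ^ k"
  shows "(sum x {s..<s + m})\<^sup>2 \<le> (real k + 1) * dyadic_squares x k s"
  using assms
proof (induction k arbitrary: s m)
  case 0
  then have "m = 0 \<or> m = 1" by auto
  then show ?case by auto
next
  case (Suc k)
  show ?case
  proof (cases "m \<le> 2 ^ k")
    case True
    have "(sum x {s..<s + m})\<^sup>2 \<le> (real k + 1) * dyadic_squares x k s"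
      using Suc.IH True by blast
    also have "\<dots> \<le> (real (Suc k) + 1) * dyadic_squares x (Suc k) s"
      by (intro mult_mono) (auto simp: dyadic_squares_nonneg)
    finally show ?thesis .
  next
    case False
    define r where "r = m - 2 ^ k"
    have m: "m = 2 ^ k + r" and r: "r \<le> 2 ^ k"
      using False Suc.prems by (auto simp: r_def)
    have "sum x {s..<s + m} = sum x {s..<s + 2 ^ k} + sum x {s + 2 ^ k..<(s + 2 ^ k) + r}"
      by (simp add: m sum.atLeastLessThan_concat add.assoc)
    then have "(sum x {s..<s + m})\<^sup>2 \<le>
        (real k + 1 + 1) * ((sum x {s..<s + 2 ^ k})\<^sup>2 + dyadic_squares x k (s + 2 ^ k))"
      using square_add_le_weighted[OF _ Suc.IH[OF r]] by simp
    also have "\<dots> \<le> (real (Suc k) + 1) * dyadic_squares x (Suc k) s"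
      by (intro mult_mono) (auto simp: dyadic_squares_nonneg)
    finally show ?thesis .
  qed
qed

lemma sum_dyadic_blocks:
  fixes g :: "nat \<Rightarrow> 'a::comm_monoid_add"
  shows "(\<Sum>j<k. sum g {2 ^ j..<2 ^ Suc j}) = sum g {1..<2 ^ k}"
proof (induction k)
  case (Suc k)
  then show ?case
    using sum.atLeastLessThan_concat[of 1 "2 ^ k" "2 ^ Suc k" g] by simp
qed simp

lemma filterlim_floor_log: "filterlim floor_log at_top sequentially"
proof (subst filterlim_at_top, intro allI)
  fix K
  have "K \<le> floor_log n" if "2 ^ K \<le> n" for n
    using floor_log_le_iff[OF that] by simp
  then show "\<forall>\<^sub>F n in sequentially. K \<le> floor_log n"
    using eventually_sequentially by blast
qed

text \<open>
  The first hypothesis makes the partial sums up to \<open>2 ^ k\<close> converge, the second one makes the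
  oscillation inside block \<open>k\<close> tend to 0.
\<close>

lemma summable_if_dyadic_control:
  fixes x :: "nat \<Rightarrow> real"
  assumes blocks: "summable (\<lambda>k. (real k + 1)\<^sup>2 * (sum x {2 ^ k..<2 ^ Suc k})\<^sup>2)"
    and osc: "summable (\<lambda>k. (real k + 1) * dyadic_squares x k (2 ^ k))"
  shows "summable (\<lambda>n. x (Suc n))"
proof -
  define S where "S n = sum x {1..<n}" for n
  define T where "T k = sum x {2 ^ k..<2 ^ Suc k}" for k :: nat
  define w where "w k = real k + 1" for k
  have w: "w k > 0" for k by (simp add: w_def)
  have "summable (\<lambda>k. inverse (real (Suc k) ^ 2))"
    by (subst summable_Suc_iff) (rule inverse_power_summable, simp)
  then have "summable (\<lambda>k. (w k)\<^sup>2 * (T k)\<^sup>2 + inverse ((w k)\<^sup>2))"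
    using blocks by (intro summable_add) (auto simp: w_def T_def add.commute)
  moreover have "norm (T k) \<le> (w k)\<^sup>2 * (T k)\<^sup>2 + inverse ((w k)\<^sup>2)" for k
  proof -
    \<comment> \<open>The geometric mean of the two summands on the right is \<open>\<bar>T k\<bar>\<close>.\<close>
    have "0 \<le> (w k * \<bar>T k\<bar> - inverse (w k))\<^sup>2" by simp
    also have "\<dots> = (w k)\<^sup>2 * (T k)\<^sup>2 + inverse ((w k)\<^sup>2) - 2 * \<bar>T k\<bar>"
      using w[of k] by (simp add: power2_diff power_mult_distrib power_inverse)
    finally show ?thesis by simp
  qed
  ultimately have "summable T"
    by (rule summable_comparison_test')
  then have "(\<lambda>k. \<Sum>j<k. T j) \<longlonglongrightarrow> suminf T"
    by (rule summable_LIMSEQ)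
  then have "(\<lambda>k. S (2 ^ k)) \<longlonglongrightarrow> suminf T"
    using sum_dyadic_blocks[of x] by (simp add: S_def T_def)
  then have L: "(\<lambda>n. S (2 ^ floor_log n)) \<longlonglongrightarrow> suminf T"
    by (rule filterlim_compose[OF _ filterlim_floor_log])
  define R where "R k = sqrt ((real k + 1) * dyadic_squares x k (2 ^ k))" for k
  have "R \<longlonglongrightarrow> sqrt 0"
    unfolding R_def using osc by (intro tendsto_real_sqrt summable_LIMSEQ_zero)
  then have R: "(\<lambda>n. R (floor_log n)) \<longlonglongrightarrow> 0"
    by (intro filterlim_compose[OF _ filterlim_floor_log]) simp
  have "norm (S n - S (2 ^ floor_log n)) \<le> R (floor_log n)" if "n \<ge> 1" for n
  proof -
    define k where "k = floor_log n"
    have lo: "2 ^ k \<le> n" and hi: "n < 2 * 2 ^ k"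
      using floor_log_exp2_le[of n] floor_log_exp2_gt[of n] that by (auto simp: k_def)
    define m where "m = n - 2 ^ k"
    have m: "n = 2 ^ k + m" "m \<le> 2 ^ k"
      using lo hi by (auto simp: m_def)
    have "S n - S (2 ^ k) = sum x {2 ^ k..<2 ^ k + m}"
      using sum.atLeastLessThan_concat[of 1 "2 ^ k" n x] lo by (simp add: S_def m(1))
    then have "(S n - S (2 ^ k))\<^sup>2 \<le> (real k + 1) * dyadic_squares x k (2 ^ k)"
      using square_prefix_sum_le[OF m(2)] by simp
    then show ?thesis
      by (simp add: R_def k_def real_le_rsqrt)
  qed
  then have "(\<lambda>n. S n - S (2 ^ floor_log n)) \<longlonglongrightarrow> 0"
    by (intro Lim_null_comparison[OF _ R] eventually_sequentiallyI[of 1]) auto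
  from tendsto_add[OF this L] have "S \<longlonglongrightarrow> suminf T" by simp
  then have "(\<lambda>n. S (Suc n)) \<longlonglongrightarrow> suminf T" by (rule LIMSEQ_Suc)
  moreover have "S (Suc n) = (\<Sum>i<n. x (Suc i))" for n
    unfolding S_def One_nat_def sum.atLeast_Suc_lessThan_Suc_shift
    by (simp add: atLeast0LessThan)
  ultimately show ?thesis
    by (auto simp: summable_def sums_def)
qed

section \<open>The logarithmic condition\<close>

lemma block_weight_le_log:
  assumes "2 ^ k \<le> n"
  shows "real k + 1 \<le> 2 * log 2 (real n + 1)"
proof -
  have n: "real n \<ge> 2 ^ k" using assms by (metis of_nat_le_iff of_nat_numeral of_nat_power)
  have "real k \<le> log 2 (real n + 1)"
  proof (subst le_log_iff)
    show "2 powr real k \<le> real n + 1"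
      using n unfolding powr_realpow[OF zero_less_numeral] by linarith
  qed auto
  moreover have "1 \<le> log 2 (real n + 1)"
  proof (subst le_log_iff)
    have "(1::real) \<le> 2 ^ k" by simp
    then show "2 powr 1 \<le> real n + 1"
      using n unfolding powr_one[OF zero_le_numeral] by linarith
  qed auto
  ultimately show ?thesis by linarith
qed

lemma summable_block_weights:
  fixes b :: "nat \<Rightarrow> real"
  assumes "summable (\<lambda>k. (b (Suc k))\<^sup>2 * (log 2 (real (Suc k) + 1))\<^sup>2)"
  shows "summable (\<lambda>k. (real k + 1)\<^sup>2 * (\<Sum>n\<in>{2 ^ k..<2 ^ Suc k}. (b n)\<^sup>2))"
proof -
  define g where "g n = (b n)\<^sup>2 * (log 2 (real n + 1))\<^sup>2" for n
  have g: "summable (\<lambda>k. g (Suc k))" using assms by (simp add: g_def)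
  have g0: "0 \<le> g n" for n by (simp add: g_def)
  have "summable (\<lambda>k. sum g {2 ^ k..<2 ^ Suc k})"
  proof (rule summableI_nonneg_bounded)
    fix k
    have "(\<Sum>j<k. sum g {2 ^ j..<2 ^ Suc j}) = sum g {1..<2 ^ k}"
      by (rule sum_dyadic_blocks)
    also have "\<dots> \<le> sum g {Suc 0..<Suc (2 ^ k)}"
      using g0 by (intro sum_mono2) auto
    also have "\<dots> = (\<Sum>i<2 ^ k. g (Suc i))"
      by (simp only: sum.atLeast_Suc_lessThan_Suc_shift atLeast0LessThan comp_def)
    also have "\<dots> \<le> (\<Sum>i. g (Suc i))"
      using g g0 by (intro sum_le_suminf) auto
    finally show "(\<Sum>j<k. sum g {2 ^ j..<2 ^ Suc j}) \<le> (\<Sum>i. g (Suc i))" .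
  qed (auto intro: sum_nonneg g0)
  then have "summable (\<lambda>k. 4 * sum g {2 ^ k..<2 ^ Suc k})" by (rule summable_mult)
  moreover have "norm ((real k + 1)\<^sup>2 * (\<Sum>n\<in>{2 ^ k..<2 ^ Suc k}. (b n)\<^sup>2))
      \<le> 4 * sum g {2 ^ k..<2 ^ Suc k}" for k
  proof -
    have "(real k + 1)\<^sup>2 * (b n)\<^sup>2 \<le> 4 * g n" if "n \<in> {2 ^ k..<2 ^ Suc k}" for n
    proof -
      have "(real k + 1)\<^sup>2 \<le> (2 * log 2 (real n + 1))\<^sup>2"
        using that by (intro power_mono block_weight_le_log) auto
      then have "(real k + 1)\<^sup>2 * (b n)\<^sup>2 \<le> (2 * log 2 (real n + 1))\<^sup>2 * (b n)\<^sup>2"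
        by (rule mult_right_mono) simp
      then show ?thesis by (simp add: g_def power_mult_distrib mult_ac)
    qed
    then have "(real k + 1)\<^sup>2 * (\<Sum>n\<in>{2 ^ k..<2 ^ Suc k}. (b n)\<^sup>2)
        \<le> 4 * sum g {2 ^ k..<2 ^ Suc k}"
      unfolding sum_distrib_left by (rule sum_mono)
    then show ?thesis by (simp add: sum_nonneg)
  qed
  ultimately show ?thesis by (rule summable_comparison_test')
qed

section \<open>Second moments under nonpositive correlation\<close>

lemma AE_summable_if_summable_integral:
  fixes f :: "nat \<Rightarrow> 'w \<Rightarrow> real"
  assumes int: "\<And>k. integrable M (f k)" and nn: "\<And>k \<omega>. 0 \<le> f k \<omega>"
    and sum: "summable (\<lambda>k. integral\<^sup>L M (f k))"
  shows "AE \<omega> in M. summable (\<lambda>k. f k \<omega>)"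
proof -
  have meas[measurable]: "f k \<in> borel_measurable M" for k using int by auto
  have "(\<integral>\<^sup>+ \<omega>. (\<Sum>k. ennreal (f k \<omega>)) \<partial>M) = (\<Sum>k. \<integral>\<^sup>+ \<omega>. ennreal (f k \<omega>) \<partial>M)"
    by (rule nn_integral_suminf) simp
  also have "\<dots> = (\<Sum>k. ennreal (integral\<^sup>L M (f k)))"
    using int nn by (simp add: nn_integral_eq_integral)
  also have "\<dots> = ennreal (\<Sum>k. integral\<^sup>L M (f k))"
    using sum nn by (simp add: suminf_ennreal2 integral_nonneg_AE)
  finally have "(\<integral>\<^sup>+ \<omega>. (\<Sum>k. ennreal (f k \<omega>)) \<partial>M) \<noteq> \<infinity>" by simp
  then have "AE \<omega> in M. (\<Sum>k. ennreal (f k \<omega>)) \<noteq> \<infinity>"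
    by (intro nn_integral_PInf_AE) auto
  then show ?thesis
  proof eventually_elim
    case (elim \<omega>)
    then show ?case
      using nn by (intro summable_suminf_not_top) auto
  qed
qed

lemma integrable_mult_square_integrable:
  fixes f g :: "'w \<Rightarrow> real"
  assumes [measurable]: "f \<in> borel_measurable M" "g \<in> borel_measurable M"
    and "integrable M (\<lambda>\<omega>. (f \<omega>)\<^sup>2)" "integrable M (\<lambda>\<omega>. (g \<omega>)\<^sup>2)"
  shows "integrable M (\<lambda>\<omega>. f \<omega> * g \<omega>)"
proof (rule Bochner_Integration.integrable_bound)
  show "integrable M (\<lambda>\<omega>. (f \<omega>)\<^sup>2 + (g \<omega>)\<^sup>2)" using assms by simp
  have "\<bar>u * v\<bar> \<le> u\<^sup>2 + v\<^sup>2" for u v :: real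
  proof -
    have "2 * (\<bar>u\<bar> * \<bar>v\<bar>) \<le> u\<^sup>2 + v\<^sup>2"
      using sum_squares_bound[of "\<bar>u\<bar>" "\<bar>v\<bar>"] by (simp add: mult.assoc)
    moreover have "0 \<le> \<bar>u\<bar> * \<bar>v\<bar>" by simp
    ultimately show ?thesis by (simp only: abs_mult)
  qed
  then show "AE \<omega> in M. norm (f \<omega> * g \<omega>) \<le> norm ((f \<omega>)\<^sup>2 + (g \<omega>)\<^sup>2)" by simp
qed measurable

locale nonpos_correlated =
  fixes M :: "'w measure" and X :: "nat \<Rightarrow> 'w \<Rightarrow> real"
  assumes meas: "\<And>n. n \<ge> 1 \<Longrightarrow> X n \<in> borel_measurable M"
    and second_moment: "\<And>n. n \<ge> 1 \<Longrightarrow> (\<integral>\<omega>. (X n \<omega>)\<^sup>2 \<partial>M) = 1"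
    and nonpos: "\<And>n m. n \<ge> 1 \<Longrightarrow> m \<ge> 1 \<Longrightarrow> n \<noteq> m \<Longrightarrow> (\<integral>\<omega>. X n \<omega> * X m \<omega> \<partial>M) \<le> 0"
begin

lemma integrable_product:
  assumes "n \<ge> 1" "m \<ge> 1"
  shows "integrable M (\<lambda>\<omega>. X n \<omega> * X m \<omega>)"
proof -
  \<comment> \<open>The integral of a function that is not integrable is 0, so second moment 1 includes integrability.\<close>
  have "integrable M (\<lambda>\<omega>. (X n \<omega>)\<^sup>2)" if "n \<ge> 1" for n
    using second_moment[OF that] not_integrable_integral_eq by fastforce
  then show ?thesis
    using assms meas by (intro integrable_mult_square_integrable) auto
qed

lemma square_sum_expand:
  fixes b :: "nat \<Rightarrow> real"
  shows "(\<Sum>n\<in>I. b n * X n \<omega>)\<^sup>2 = (\<Sum>n\<in>I. \<Sum>m\<in>I. b n * b m * (X n \<omega> * X m \<omega>))"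
  by (simp add: power2_eq_square sum_product mult_ac)

lemma integrable_square_sum:
  assumes "\<And>n. n \<in> I \<Longrightarrow> n \<ge> 1"
  shows "integrable M (\<lambda>\<omega>. (\<Sum>n\<in>I. b n * X n \<omega>)\<^sup>2)"
  unfolding square_sum_expand using assms
  by (intro Bochner_Integration.integrable_sum integrable_mult_right integrable_product) auto

lemma second_moment_sum_le:
  assumes I: "finite I" "\<And>n. n \<in> I \<Longrightarrow> n \<ge> 1" and b: "\<And>n. 0 \<le> b n"
  shows "(\<integral>\<omega>. (\<Sum>n\<in>I. b n * X n \<omega>)\<^sup>2 \<partial>M) \<le> (\<Sum>n\<in>I. (b n)\<^sup>2)"
proof -
  have int: "integrable M (\<lambda>\<omega>. b n * b m * (X n \<omega> * X m \<omega>))" if "n \<in> I" "m \<in> I" for n m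
    using that I(2) by (intro integrable_mult_right integrable_product)
  have "(\<integral>\<omega>. (\<Sum>n\<in>I. b n * X n \<omega>)\<^sup>2 \<partial>M)
      = (\<Sum>n\<in>I. \<integral>\<omega>. (\<Sum>m\<in>I. b n * b m * (X n \<omega> * X m \<omega>)) \<partial>M)"
    unfolding square_sum_expand
    by (intro Bochner_Integration.integral_sum Bochner_Integration.integrable_sum int)
  also have "\<dots> = (\<Sum>n\<in>I. \<Sum>m\<in>I. \<integral>\<omega>. b n * b m * (X n \<omega> * X m \<omega>) \<partial>M)"
    by (intro sum.cong refl Bochner_Integration.integral_sum int)
  also have "\<dots> = (\<Sum>n\<in>I. \<Sum>m\<in>I. b n * b m * (\<integral>\<omega>. X n \<omega> * X m \<omega> \<partial>M))"
    unfolding integral_mult_right_zero by (rule refl)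
  also have "\<dots> \<le> (\<Sum>n\<in>I. \<Sum>m\<in>I. if m = n then (b n)\<^sup>2 else 0)"
  proof (intro sum_mono)
    fix n m assume "n \<in> I" "m \<in> I"
    then show "b n * b m * (\<integral>\<omega>. X n \<omega> * X m \<omega> \<partial>M) \<le> (if m = n then (b n)\<^sup>2 else 0)"
      using second_moment[of n] nonpos[of n m] I b
      by (auto simp: power2_eq_square intro!: mult_nonneg_nonpos)
  qed
  also have "\<dots> = (\<Sum>n\<in>I. (b n)\<^sup>2)" using I by simp
  finally show ?thesis .
qed

lemma integrable_dyadic_squares:
  assumes "s \<ge> 1"
  shows "integrable M (\<lambda>\<omega>. dyadic_squares (\<lambda>n. b n * X n \<omega>) k s)"
  using assms
proof (induction k arbitrary: s)
  case 0
  then show ?case using integrable_square_sum[of "{s}" b] by simp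
next
  case (Suc k)
  then show ?case
    by (auto intro!: integrable_square_sum)
qed

text \<open>Each of the \<open>k + 1\<close> dyadic levels contributes at most the sum of the squared coefficients.\<close>

lemma integral_dyadic_squares_le:
  assumes "s \<ge> 1" and b: "\<And>n. 0 \<le> b n"
  shows "(\<integral>\<omega>. dyadic_squares (\<lambda>n. b n * X n \<omega>) k s \<partial>M)
         \<le> (real k + 1) * (\<Sum>n\<in>{s..<s + 2 ^ k}. (b n)\<^sup>2)"
  using assms(1)
proof (induction k arbitrary: s)
  case 0
  then show ?case using second_moment_sum_le[of "{s}" b] b by simp
next
  case (Suc k)
  define A where "A s = (\<Sum>n\<in>{s..<s + 2 ^ k}. (b n)\<^sup>2)" for s
  have split: "(\<Sum>n\<in>{s..<s + 2 ^ Suc k}. (b n)\<^sup>2) = A s + A (s + 2 ^ k)"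
    using sum.atLeastLessThan_concat[of s "s + 2 ^ k" "s + 2 ^ Suc k" "\<lambda>n. (b n)\<^sup>2"]
    by (simp add: A_def mult_2 add.assoc)
  have "(\<integral>\<omega>. dyadic_squares (\<lambda>n. b n * X n \<omega>) (Suc k) s \<partial>M)
      = (\<integral>\<omega>. dyadic_squares (\<lambda>n. b n * X n \<omega>) k s \<partial>M)
        + (\<integral>\<omega>. dyadic_squares (\<lambda>n. b n * X n \<omega>) k (s + 2 ^ k) \<partial>M)
        + (\<integral>\<omega>. (\<Sum>n\<in>{s..<s + 2 ^ k}. b n * X n \<omega>)\<^sup>2 \<partial>M)"
  proof -
    have "integrable M (\<lambda>\<omega>. dyadic_squares (\<lambda>n. b n * X n \<omega>) k s)"
      and "integrable M (\<lambda>\<omega>. dyadic_squares (\<lambda>n. b n * X n \<omega>) k (s + 2 ^ k))"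
      using Suc.prems by (auto intro!: integrable_dyadic_squares)
    moreover have "integrable M (\<lambda>\<omega>. (\<Sum>n\<in>{s..<s + 2 ^ k}. b n * X n \<omega>)\<^sup>2)"
      using Suc.prems by (intro integrable_square_sum) auto
    ultimately show ?thesis by simp
  qed
  also have "\<dots> \<le> (real k + 1) * A s + (real k + 1) * A (s + 2 ^ k) + A s"
    unfolding A_def using Suc.prems b
    by (intro add_mono Suc.IH second_moment_sum_le) auto
  also have "\<dots> \<le> (real (Suc k) + 1) * (A s + A (s + 2 ^ k))"
    using sum_nonneg[of "{s + 2 ^ k..<s + 2 ^ k + 2 ^ k}" "\<lambda>n. (b n)\<^sup>2"]
    by (simp add: A_def algebra_simps)
  finally show ?case unfolding split .
qed

section \<open>Almost sure convergence\<close>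

lemma AE_summable_nonneg_coefficients:
  assumes b: "\<And>n. 0 \<le> b n"
    and log: "summable (\<lambda>k. (b (Suc k))\<^sup>2 * (log 2 (real (Suc k) + 1))\<^sup>2)"
  shows "AE \<omega> in M. summable (\<lambda>k. b (Suc k) * X (Suc k) \<omega>)"
proof -
  define A where "A k = (\<Sum>n\<in>{2 ^ k..<2 ^ Suc k}. (b n)\<^sup>2)" for k :: nat
  have sumA: "summable (\<lambda>k. (real k + 1)\<^sup>2 * A k)"
    unfolding A_def by (rule summable_block_weights[OF log])
  have ge1: "n \<ge> 1" if "n \<in> {2 ^ k..<2 ^ Suc k}" for n k :: nat
  proof -
    have "(1::nat) \<le> 2 ^ k" by simp
    then show ?thesis using that by (metis atLeastLessThan_iff order_trans)
  qed
  define F where "F k \<omega> = (real k + 1)\<^sup>2 * (\<Sum>n\<in>{2 ^ k..<2 ^ Suc k}. b n * X n \<omega>)\<^sup>2" for k \<omega>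
  define G where "G k \<omega> = (real k + 1) * dyadic_squares (\<lambda>n. b n * X n \<omega>) k (2 ^ k)" for k \<omega>
  have "AE \<omega> in M. summable (\<lambda>k. F k \<omega>)"
  proof (rule AE_summable_if_summable_integral)
    show "integrable M (F k)" for k
      unfolding F_def using ge1 by (intro integrable_mult_right integrable_square_sum) blast
    show "0 \<le> F k \<omega>" for k \<omega> by (simp add: F_def)
    have "integral\<^sup>L M (F k) \<le> (real k + 1)\<^sup>2 * A k" for k
    proof -
      have "(\<integral>\<omega>. (\<Sum>n\<in>{2 ^ k..<2 ^ Suc k}. b n * X n \<omega>)\<^sup>2 \<partial>M) \<le> A k"
        unfolding A_def using b ge1 by (intro second_moment_sum_le) auto
      then show ?thesis
        unfolding F_def integral_mult_right_zero by (intro mult_left_mono) auto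
    qed
    moreover have "0 \<le> integral\<^sup>L M (F k)" for k by (simp add: F_def)
    ultimately show "summable (\<lambda>k. integral\<^sup>L M (F k))"
      by (intro summable_comparison_test'[OF sumA]) auto
  qed
  moreover have "AE \<omega> in M. summable (\<lambda>k. G k \<omega>)"
  proof (rule AE_summable_if_summable_integral)
    show "integrable M (G k)" for k
      unfolding G_def by (intro integrable_mult_right integrable_dyadic_squares) simp
    show G0: "0 \<le> G k \<omega>" for k \<omega> by (simp add: G_def dyadic_squares_nonneg)
    have "integral\<^sup>L M (G k) \<le> (real k + 1)\<^sup>2 * A k" for k
    proof -
      have "(\<integral>\<omega>. dyadic_squares (\<lambda>n. b n * X n \<omega>) k (2 ^ k) \<partial>M) \<le> (real k + 1) * A k"
        using integral_dyadic_squares_le[of "2 ^ k" b k] b by (simp add: A_def mult_2)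
      then have "(real k + 1) * (\<integral>\<omega>. dyadic_squares (\<lambda>n. b n * X n \<omega>) k (2 ^ k) \<partial>M)
          \<le> (real k + 1) * ((real k + 1) * A k)"
        by (intro mult_left_mono) auto
      then show ?thesis
        unfolding G_def integral_mult_right_zero by (simp add: power2_eq_square mult.assoc)
    qed
    moreover have "0 \<le> integral\<^sup>L M (G k)" for k using G0 by simp
    ultimately show "summable (\<lambda>k. integral\<^sup>L M (G k))"
      by (intro summable_comparison_test'[OF sumA]) auto
  qed
  ultimately show ?thesis
  proof eventually_elim
    case (elim \<omega>)
    then show ?case
      unfolding F_def G_def by (intro summable_if_dyadic_control)
  qed
qed

lemma AE_summable_dominated_coefficients:
  fixes r :: "nat \<Rightarrow> real"
  assumes dom: "\<And>n. \<bar>r n\<bar> \<le> c n"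
    and log: "summable (\<lambda>k. (c (Suc k))\<^sup>2 * (log 2 (real (Suc k) + 1))\<^sup>2)"
  shows "AE \<omega> in M. summable (\<lambda>k. r (Suc k) * X (Suc k) \<omega>)"
proof -
  have dominated: "AE \<omega> in M. summable (\<lambda>k. b (Suc k) * X (Suc k) \<omega>)"
    if b: "\<And>n. 0 \<le> b n" "\<And>n. b n \<le> \<bar>r n\<bar>" for b
  proof (rule AE_summable_nonneg_coefficients[OF b(1)])
    have "(b n)\<^sup>2 \<le> (c n)\<^sup>2" for n
      using b dom by (meson order_trans power_mono)
    then show "summable (\<lambda>k. (b (Suc k))\<^sup>2 * (log 2 (real (Suc k) + 1))\<^sup>2)"
      by (intro summable_comparison_test'[OF log]) (auto intro!: mult_right_mono)
  qed
  have "AE \<omega> in M. summable (\<lambda>k. max (r (Suc k)) 0 * X (Suc k) \<omega>)"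
    by (rule dominated[of "\<lambda>n. max (r n) 0"]) auto
  moreover have "AE \<omega> in M. summable (\<lambda>k. max (- r (Suc k)) 0 * X (Suc k) \<omega>)"
    by (rule dominated[of "\<lambda>n. max (- r n) 0"]) auto
  ultimately show ?thesis
  proof eventually_elim
    case (elim \<omega>)
    have "max t 0 * y - max (- t) 0 * y = t * y" for t y :: real
      by (auto simp: max_def)
    then show ?case using summable_diff[OF elim] by simp
  qed
qed

end

theorem corollary1:
  fixes M :: "'w measure"
    and a :: "nat \<Rightarrow> complex"
    and X :: "nat \<Rightarrow> 'w \<Rightarrow> real"
  assumes "prob_space M"
    and "\<And>n. n \<ge> 1 \<Longrightarrow> X n \<in> borel_measurable M"
    and "\<And>n. n \<ge> 1 \<Longrightarrow> prob_space.expectation M (\<lambda>\<omega>. (X n \<omega>)\<^sup>2) = 1"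
    and "\<And>n m. n \<ge> 1 \<Longrightarrow> m \<ge> 1 \<Longrightarrow> n \<noteq> m \<Longrightarrow>
           prob_space.expectation M (\<lambda>\<omega>. X n \<omega> * X m \<omega>) \<le> 0"
    and "summable (\<lambda>k. (cmod (a (Suc k)))\<^sup>2 * (log 2 (real (Suc k) + 1))\<^sup>2)"
  shows "AE \<omega> in M. summable (\<lambda>k. a (Suc k) * complex_of_real (X (Suc k) \<omega>))"
proof -
  interpret nonpos_correlated M X
    using assms(2-4) by unfold_locales auto
  have "AE \<omega> in M. summable (\<lambda>k. Re (a (Suc k)) * X (Suc k) \<omega>)"
    by (rule AE_summable_dominated_coefficients[OF abs_Re_le_cmod assms(5)])
  moreover have "AE \<omega> in M. summable (\<lambda>k. Im (a (Suc k)) * X (Suc k) \<omega>)"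
    by (rule AE_summable_dominated_coefficients[OF abs_Im_le_cmod assms(5)])
  ultimately show ?thesis
    by eventually_elim (simp add: summable_complex_iff)
qed

end
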